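(* With the terms $M'$ and $N$ of the symmetric $\lambda\mu$-calculus given by $M'=\langle (\beta\;\lambda x(x\;M_1)),(\beta\;\lambda x(x\;M_0))\rangle$ and $N=(\alpha\;\lambda z(\alpha\;z))$, where $\alpha,\beta$ are $\mu$-variables and $M_0$, $M_1$ and the pairing $\langle\cdot,\cdot\rangle$ are the explicit terms defined in the context, one has $M'[\beta=_r\mu\alpha N]\in SN$ but $(\mu\beta M'\;\mu\alpha N)\notin SN$.
   Context: Terms of the (untyped) symmetric $\lambda\mu$-calculus are given by the grammar $\mathcal T ::= x \mid \lambda x\,\mathcal T \mid (\mathcal T\;\mathcal T) \mid \mu\alpha\,\mathcal T \mid (\alpha\;\mathcal T)$, where $x,y,\dots$ range over $\lambda$-variables and $\alpha,\beta,\dots$ over $\mu$-variables ($\lambda x$ binds $x$, $\mu\alpha$ binds $\alpha$; terms are taken up to renaming of bound variables, and substitutions are capture-avoiding). Application associates to the left: $(M\;N_1\dots N_n)$ means $((M\;N_1)\dots N_n)$. One-step reduction $\triangleright$ is the closure under all term contexts of the three rules ($\beta$) $(\lambda x M\;N)\triangleright M[x:=N]$; ($\mu$) $(\mu\alpha M\;N)\triangleright \mu\alpha\, M[\alpha=_r N]$; ($\mu'$) $(M\;\mu\alpha N)\triangleright \mu\alpha\, N[\alpha=_l M]$. Here $M[\alpha=_r N]$ is obtained from $M$ by (recursively) replacing each sub-term of $M$ of the form $(\alpha\;U)$ ($\alpha$ free) by $(\alpha\;(U\;N))$, and $N[\alpha=_l M]$ is obtained from $N$ by (recursively) replacing each sub-term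 of $N$ of the form $(\alpha\;U)$ by $(\alpha\;(M\;U))$. $SN$ is the set of terms having no infinite $\triangleright$-reduction sequence. Explicit terms: $\underline 0=\lambda x\lambda y\, y$, $\underline 1=\lambda x\lambda y\, x$, $\Delta=\lambda x (x\;x)$, $P=\lambda x\lambda y\lambda z\,\big(y\;(z\;\underline 1\;\underline 0)\;(z\;\underline 0\;\underline 1)\;(\lambda d\,\underline 1)\;\Delta\;\Delta\big)$, $M_0=\lambda x(x\;P\;\underline 0)$, $M_1=\lambda x(x\;P\;\underline 1)$. For terms $T_1,T_0$, $\langle T_1,T_0\rangle$ denotes the term $\lambda f(f\;T_1\;T_0)$ where $f$ is a fresh $\lambda$-variable. *)

theory Defs
  imports Main
begin

text \<open>
  Terms up to renaming of bound variables, in de Bruijn form with two independent families of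
  indices: \<open>Lam\<close> binds \<open>\<lambda>\<close>-index 0 and \<open>Mu\<close> binds \<open>\<mu>\<close>-index 0.  An index that
  points beyond the enclosing binders is a free variable; at top level the natural number \<open>n\<close>
  thus serves as the name of the \<open>n\<close>-th \<open>\<lambda>\<close>- or \<open>\<mu>\<close>-variable.
  \<open>Named a M\<close> is the term \<open>(a M)\<close>.
\<close>

datatype trm =
    Var nat
  | Lam trm
  | App trm trm  (infixl \<open>\<cdot>\<close> 200)
  | Mu trm
  | Named nat trm

definition up :: "(nat \<Rightarrow> nat) \<Rightarrow> nat \<Rightarrow> nat" where
  "up f = case_nat 0 (\<lambda>i. Suc (f i))"

text \<open>\<open>ren f g\<close> renames the free \<open>\<lambda>\<close>-variables by \<open>f\<close> and the free \<open>\<mu>\<close>-variables by \<open>g\<close>.\<close>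

primrec ren :: "(nat \<Rightarrow> nat) \<Rightarrow> (nat \<Rightarrow> nat) \<Rightarrow> trm \<Rightarrow> trm" where
  "ren f g (Var i) = Var (f i)"
| "ren f g (Lam M) = Lam (ren (up f) g M)"
| "ren f g (M \<cdot> N) = ren f g M \<cdot> ren f g N"
| "ren f g (Mu M) = Mu (ren f (up g) M)"
| "ren f g (Named a M) = Named (g a) (ren f g M)"

definition lift_lam :: "trm \<Rightarrow> trm" where "lift_lam = ren Suc id"
definition lift_mu :: "trm \<Rightarrow> trm" where "lift_mu = ren id Suc"

text \<open>
  The named binders \<open>\<lambda>x M\<close> and \<open>\<mu>\<alpha> M\<close>, which turn the free variable with the
  given name into the bound index 0; all other free variables keep their names.
\<close>

definition lam :: "nat \<Rightarrow> trm \<Rightarrow> trm" where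
  "lam x M = Lam (ren (\<lambda>i. if i = x then 0 else Suc i) id M)"

definition mu :: "nat \<Rightarrow> trm \<Rightarrow> trm" where
  "mu \<alpha> M = Mu (ren id (\<lambda>a. if a = \<alpha> then 0 else Suc a) M)"

text \<open>Capture-avoiding simultaneous substitution for the free \<open>\<lambda>\<close>-variables.\<close>

primrec subst :: "(nat \<Rightarrow> trm) \<Rightarrow> trm \<Rightarrow> trm" where
  "subst \<sigma> (Var i) = \<sigma> i"
| "subst \<sigma> (Lam M) = Lam (subst (case_nat (Var 0) (\<lambda>i. lift_lam (\<sigma> i))) M)"
| "subst \<sigma> (M \<cdot> N) = subst \<sigma> M \<cdot> subst \<sigma> N"
| "subst \<sigma> (Mu M) = Mu (subst (\<lambda>i. lift_mu (\<sigma> i)) M)"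
| "subst \<sigma> (Named a M) = Named a (subst \<sigma> M)"

text \<open>
  \<open>rsub \<alpha> N M\<close> is \<open>M[\<alpha> =\<^sub>r N]\<close> and \<open>lsub \<alpha> M N\<close> is \<open>N[\<alpha> =\<^sub>l M]\<close>.
\<close>

primrec rsub :: "nat \<Rightarrow> trm \<Rightarrow> trm \<Rightarrow> trm" where
  "rsub \<alpha> N (Var i) = Var i"
| "rsub \<alpha> N (Lam U) = Lam (rsub \<alpha> (lift_lam N) U)"
| "rsub \<alpha> N (U \<cdot> V) = rsub \<alpha> N U \<cdot> rsub \<alpha> N V"
| "rsub \<alpha> N (Mu U) = Mu (rsub (Suc \<alpha>) (lift_mu N) U)"
| "rsub \<alpha> N (Named a U) = Named a (if a = \<alpha> then rsub \<alpha> N U \<cdot> N else rsub \<alpha> N U)"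

primrec lsub :: "nat \<Rightarrow> trm \<Rightarrow> trm \<Rightarrow> trm" where
  "lsub \<alpha> M (Var i) = Var i"
| "lsub \<alpha> M (Lam U) = Lam (lsub \<alpha> (lift_lam M) U)"
| "lsub \<alpha> M (U \<cdot> V) = lsub \<alpha> M U \<cdot> lsub \<alpha> M V"
| "lsub \<alpha> M (Mu U) = Mu (lsub (Suc \<alpha>) (lift_mu M) U)"
| "lsub \<alpha> M (Named a U) = Named a (if a = \<alpha> then M \<cdot> lsub \<alpha> M U else lsub \<alpha> M U)"

text \<open>
  In the rules \<open>mu_r\<close> and \<open>mu_l\<close> the binder \<open>Mu\<close> survives, so the argument moved under it is
  lifted, and the substituted \<open>\<mu>\<close>-variable is the bound index 0.
\<close>

inductive red :: "trm \<Rightarrow> trm \<Rightarrow> bool"  (infix \<open>\<rhd>\<close> 50) where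
  beta: "Lam M \<cdot> N \<rhd> subst (case_nat N Var) M"
| mu_r: "Mu M \<cdot> N \<rhd> Mu (rsub 0 (lift_mu N) M)"
| mu_l: "M \<cdot> Mu N \<rhd> Mu (lsub 0 (lift_mu M) N)"
| Lam: "M \<rhd> M' \<Longrightarrow> Lam M \<rhd> Lam M'"
| AppL: "M \<rhd> M' \<Longrightarrow> M \<cdot> N \<rhd> M' \<cdot> N"
| AppR: "N \<rhd> N' \<Longrightarrow> M \<cdot> N \<rhd> M \<cdot> N'"
| Mu: "M \<rhd> M' \<Longrightarrow> Mu M \<rhd> Mu M'"
| Named: "M \<rhd> M' \<Longrightarrow> Named a M \<rhd> Named a M'"

definition SN :: "trm set" where
  "SN = {M. \<not> (\<exists>f :: nat \<Rightarrow> trm. f 0 = M \<and> (\<forall>i. f i \<rhd> f (Suc i)))}"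

definition zero_tm :: trm where "zero_tm = lam 0 (lam 1 (Var 1))"
definition one_tm :: trm where "one_tm = lam 0 (lam 1 (Var 0))"
definition Delta :: trm where "Delta = lam 0 (Var 0 \<cdot> Var 0)"

text \<open>The \<open>\<lambda>\<close>-variables \<open>x, y, z, d\<close> are named 0, 1, 2, 3.\<close>

definition P_tm :: trm where
  "P_tm = lam 0 (lam 1 (lam 2
     (Var 1 \<cdot> (Var 2 \<cdot> one_tm \<cdot> zero_tm) \<cdot> (Var 2 \<cdot> zero_tm \<cdot> one_tm) \<cdot> lam 3 one_tm \<cdot> Delta \<cdot> Delta)))"

definition M0 :: trm where "M0 = lam 0 (Var 0 \<cdot> P_tm \<cdot> zero_tm)"
definition M1 :: trm where "M1 = lam 0 (Var 0 \<cdot> P_tm \<cdot> one_tm)"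

text \<open>\<open>\<lambda>f (f T\<^sub>1 T\<^sub>0)\<close>, where lifting the components makes \<open>f\<close> fresh for them.\<close>

definition pair :: "trm \<Rightarrow> trm \<Rightarrow> trm"  (\<open>\<langle>_, _\<rangle>\<close>) where
  "\<langle>T1, T0\<rangle> = Lam (Var 0 \<cdot> lift_lam T1 \<cdot> lift_lam T0)"

end

theory Submission
  imports Defs
begin

text \<open>
  Write \<open>A\<^sub>i = \<lambda>x (x M\<^sub>i)\<close> and \<open>K = \<mu>\<alpha> N\<close>.  The term \<open>(M\<^sub>i M\<^sub>j)\<close> reduces to \<open>(P P j i)\<close>, and hence
  to \<open>(\<Delta> \<Delta>)\<close> if \<open>i \<noteq> j\<close>, whereas \<open>(M\<^sub>i M\<^sub>i)\<close> has a finite reduction graph.  In \<open>M'[\<beta> =\<^sub>r K]\<close> the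
  two terms \<open>(A\<^sub>1 K)\<close> and \<open>(A\<^sub>0 K)\<close> stay apart, so only \<open>(M\<^sub>i M\<^sub>i)\<close> can ever arise.  In
  \<open>(\<mu>\<beta> M' K)\<close>, on the other hand, rule \<open>\<mu>'\<close> first doubles \<open>\<mu>\<beta> M'\<close>, because \<open>\<alpha>\<close> occurs twice in
  \<open>N\<close>; following \<open>A\<^sub>1\<close> in one copy and \<open>A\<^sub>0\<close> in the other produces \<open>(A\<^sub>0 M\<^sub>1)\<close>, hence \<open>(M\<^sub>1 M\<^sub>0)\<close>.
\<close>

text \<open>Accessibility supplies induction on \<open>SN\<close>; dependent choice turns its
  failure into an infinite reduction.\<close>

lemma SN_eq_accp: "SN = {M. Wellfounded.accp (\<lambda>u t. t \<rhd> u) M}"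
proof -
  have "M \<in> SN" if "Wellfounded.accp (\<lambda>u t. t \<rhd> u) M" for M
    using that
  proof (induction rule: accp.induct)
    case (accI t)
    have False if "f 0 = t" and f: "\<forall>i. f i \<rhd> f (Suc i)" for f
    proof -
      have "f (Suc 0) \<in> SN" using accI.IH that by metis
      then show False using f by (auto simp: SN_def dest: spec[of _ "\<lambda>i. f (Suc i)"])
    qed
    then show ?case by (auto simp: SN_def)
  qed
  moreover have "Wellfounded.accp (\<lambda>u t. t \<rhd> u) M" if "M \<in> SN" for M
  proof (rule ccontr)
    let ?Q = "\<lambda>t. \<not> Wellfounded.accp (\<lambda>u t. t \<rhd> u) t"
    assume "?Q M"
    moreover have "\<exists>u. ?Q u \<and> t \<rhd> u" if "?Q t" for t
      using that by (blast intro: accp.accI)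
    \<comment> \<open>The clause \<open>i = 0 \<longrightarrow> t = M\<close> pins the start of the
      chosen sequence.\<close>
    ultimately obtain f where "f 0 = M" "\<And>i. ?Q (f i) \<and> f i \<rhd> f (Suc i)"
      using dependent_nat_choice[of "\<lambda>i t. ?Q t \<and> (i = 0 \<longrightarrow> t = M)" "\<lambda>_ t u. t \<rhd> u"]
      by auto
    then show False using \<open>M \<in> SN\<close> by (auto simp: SN_def)
  qed
  ultimately show ?thesis by blast
qed

lemma SN_I: "(\<And>u. t \<rhd> u \<Longrightarrow> u \<in> SN) \<Longrightarrow> t \<in> SN"
  by (auto simp: SN_eq_accp intro: accp.accI)

lemma SN_red: "t \<in> SN \<Longrightarrow> t \<rhd> u \<Longrightarrow> u \<in> SN"
  by (auto simp: SN_eq_accp dest: accp_downward)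

lemma SN_induct [consumes 1, case_names step]:
  assumes "t \<in> SN" and "\<And>t. t \<in> SN \<Longrightarrow> (\<And>u. t \<rhd> u \<Longrightarrow> Q u) \<Longrightarrow> Q t"
  shows "Q t"
proof -
  have "Wellfounded.accp (\<lambda>u t. t \<rhd> u) t" using assms(1) by (simp add: SN_eq_accp)
  then show ?thesis
    by induction (auto simp: SN_eq_accp intro: assms(2) accp.accI)
qed

inductive_cases red_VarE: "Var i \<rhd> u"
  and red_LamE: "Lam M \<rhd> u"
  and red_NamedE: "Named a M \<rhd> u"
  and red_AppE: "M \<cdot> N \<rhd> u"

lemma SN_Lam: "M \<in> SN \<Longrightarrow> Lam M \<in> SN"
  by (induction rule: SN_induct) (blast intro: SN_I elim: red_LamE)

text \<open>The two outer applications never become redexes, so every reduction acts inside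
  \<open>S\<close> or \<open>T\<close>.\<close>

lemma SN_Var_Named_Named:
  assumes "S \<in> SN" and "T \<in> SN"
  shows "Var i \<cdot> Named a S \<cdot> Named b T \<in> SN"
  using assms
proof (induction arbitrary: T rule: SN_induct)
  case (step S)
  note IH = step.IH
  from \<open>T \<in> SN\<close> show ?case
  proof (induction rule: SN_induct)
    case (step T)
    show ?case
    proof (rule SN_I)
      fix u assume "Var i \<cdot> Named a S \<cdot> Named b T \<rhd> u"
      then show "u \<in> SN"
        by (elim red_AppE red_NamedE red_VarE trm.distinct[THEN notE]) (auto intro: IH step)
    qed
  qed
qed

primrec reds :: "trm \<Rightarrow> trm list" where
  "reds (Var i) = []"
| "reds (Lam M) = map Lam (reds M)"
| "reds (M \<cdot> N) =
    (case N of Mu V \<Rightarrow> [Mu (lsub 0 (lift_mu M) V)] | _ \<Rightarrow> [])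
    @ (case M of Lam U \<Rightarrow> [subst (case_nat N Var) U] | Mu U \<Rightarrow> [Mu (rsub 0 (lift_mu N) U)] | _ \<Rightarrow> [])
    @ map (\<lambda>M'. M' \<cdot> N) (reds M) @ map ((\<cdot>) M) (reds N)"
| "reds (Mu M) = map Mu (reds M)"
| "reds (Named a M) = map (Named a) (reds M)"

lemma red_iff_reds: "t \<rhd> u \<longleftrightarrow> u \<in> set (reds t)"
proof
  show "t \<rhd> u \<Longrightarrow> u \<in> set (reds t)" by (induction rule: red.induct) simp_all
  show "u \<in> set (reds t) \<Longrightarrow> t \<rhd> u"
  proof (induction t arbitrary: u)
    case (App M N)
    from App.prems consider
        "u \<in> set (case N of Mu V \<Rightarrow> [Mu (lsub 0 (lift_mu M) V)] | _ \<Rightarrow> [])"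
      | "u \<in> set (case M of Lam U \<Rightarrow> [subst (case_nat N Var) U] | Mu U \<Rightarrow> [Mu (rsub 0 (lift_mu N) U)] | _ \<Rightarrow> [])"
      | M' where "M' \<in> set (reds M)" "u = M' \<cdot> N"
      | N' where "N' \<in> set (reds N)" "u = M \<cdot> N'"
      unfolding reds.simps set_append set_map Un_iff image_iff by metis
    then show ?case
    proof cases
      case 1
      then show ?thesis by (cases N) (simp_all add: red.mu_l)
    next
      case 2
      then show ?thesis by (cases M) (simp_all add: red.beta red.mu_r)
    qed (simp_all add: App.IH red.AppL red.AppR)
  qed (auto intro: red.intros)
qed

text \<open>The iterate lists the terms reached in exactly \<open>n\<close> steps, so emptiness
  bounds all reductions from \<open>t\<close>.\<close>

lemma SN_if_no_long_reduction:
  assumes "((\<lambda>ts. remdups (concat (map reds ts))) ^^ n) [t] = []"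
  shows "t \<in> SN"
proof -
  have "t \<in> SN" if "((\<lambda>ts. remdups (concat (map reds ts))) ^^ n) ts = []" "t \<in> set ts" for ts t
    using that
  proof (induction n arbitrary: ts t)
    case (Suc n)
    have "u \<in> SN" if "t \<rhd> u" for u
      using that Suc.prems
      by (intro Suc.IH[of "remdups (concat (map reds ts))"])
        (auto simp: red_iff_reds funpow_Suc_right simp del: funpow.simps)
    then show ?case by (rule SN_I)
  qed simp
  then show ?thesis using assms by simp
qed

definition first_red :: "trm \<Rightarrow> trm" where
  "first_red t = (case reds t of [] \<Rightarrow> t | u # _ \<Rightarrow> u)"

lemma SN_first_red: "t \<in> SN \<Longrightarrow> (first_red ^^ n) t \<in> SN"
proof (induction n)
  case (Suc n)
  have "first_red u = u \<or> u \<rhd> first_red u" for u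
    by (cases "reds u") (auto simp: first_red_def red_iff_reds)
  then show ?case using Suc SN_red by (metis funpow.simps(2) o_apply)
qed simp

lemma not_SN_if_loop: "t \<rhd> t \<Longrightarrow> t \<notin> SN"
  by (auto simp: SN_def intro!: exI[of _ "\<lambda>_. t"])

lemma not_SN_context:
  assumes "t \<notin> SN" and "\<And>t u. t \<rhd> u \<Longrightarrow> C t \<rhd> C u"
  shows "C t \<notin> SN"
proof -
  from assms(1) obtain f where "f 0 = t" "\<forall>i. f i \<rhd> f (Suc i)" by (auto simp: SN_def)
  then show ?thesis using assms(2) by (auto simp: SN_def intro!: exI[of _ "\<lambda>i. C (f i)"])
qed

definition A0 :: trm where "A0 = Lam (Var 0 \<cdot> M0)"
definition A1 :: trm where "A1 = Lam (Var 0 \<cdot> M1)"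
definition K_tm :: trm where "K_tm = Mu (Named 0 (Lam (Named 0 (Var 0))))"

lemma SN_A1_K: "A1 \<cdot> K_tm \<in> SN"
  by (rule SN_if_no_long_reduction[of 30]) code_simp

lemma SN_A0_K: "A0 \<cdot> K_tm \<in> SN"
  by (rule SN_if_no_long_reduction[of 30]) code_simp

lemma not_SN_A0_M1: "A0 \<cdot> M1 \<notin> SN"
proof
  assume "A0 \<cdot> M1 \<in> SN"
  then have "(first_red ^^ 14) (A0 \<cdot> M1) \<in> SN" by (rule SN_first_red)
  \<comment> \<open>Unfolding \<open>P P 0 1\<close> puts \<open>0\<close> in head position: it
    selects \<open>(1 0 1)\<close>, which reduces to \<open>0\<close> and then discards
    \<open>(\<lambda>d 1)\<close>, leaving \<open>\<Delta> \<Delta>\<close>.\<close>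
  moreover have "(first_red ^^ 14) (A0 \<cdot> M1) = Delta \<cdot> Delta" by code_simp
  moreover have "Delta \<cdot> Delta \<rhd> Delta \<cdot> Delta" unfolding red_iff_reds by code_simp
  ultimately show False using not_SN_if_loop by metis
qed

text \<open>
  The chosen reduction starts with rule \<open>\<mu>'\<close> because \<^const>\<open>reds\<close> lists the \<open>\<mu>'\<close>-reduct before
  the \<open>\<mu>\<close>-reduct.  The copy \<open>Q\<close> is then applied to \<open>S\<close>, and \<open>(A\<^sub>1 S)\<close> applies the copy of \<open>Q\<close>
  inside \<open>S\<close> to \<open>M\<^sub>1\<close>, which exposes \<open>(A\<^sub>0 M\<^sub>1)\<close>.
\<close>

lemma not_SN_Mu_K: "Mu (Lam (Var 0 \<cdot> Named 0 A1 \<cdot> Named 0 A0)) \<cdot> K_tm \<notin> SN"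
proof
  let ?Q = "Mu (Lam (Var 0 \<cdot> Named 0 A1 \<cdot> Named 0 A0))"
  \<comment> \<open>The \<mu>-index is 1 because this copy lies under the binder of
    \<open>\<beta>\<close> as well as that of \<open>\<alpha>\<close>.\<close>
  let ?S = "Lam (Named 1 (?Q \<cdot> Var 0))"
  let ?C = "\<lambda>t. Mu (Named 0 (Mu (Lam (Var 0
    \<cdot> Named 0 (Named 1 (Mu (Lam (Var 0 \<cdot> Named 0 (A1 \<cdot> M1) \<cdot> Named 0 t))))
    \<cdot> Named 0 (A0 \<cdot> ?S)))))"
  assume "?Q \<cdot> K_tm \<in> SN"
  then have "(first_red ^^ 5) (?Q \<cdot> K_tm) \<in> SN" by (rule SN_first_red)
  moreover have "(first_red ^^ 5) (?Q \<cdot> K_tm) = ?C (A0 \<cdot> M1)" by code_simp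
  moreover have "?C (A0 \<cdot> M1) \<notin> SN"
    using not_SN_A0_M1 by (rule not_SN_context) (intro red.Mu red.Named red.Lam red.AppL red.AppR)
  ultimately show False by simp
qed

lemma ren_closed:
  "ren f g M0 = M0" "ren f g M1 = M1"
  "ren f g A0 = A0" "ren f g A1 = A1" "ren f g K_tm = K_tm"
  by (simp_all add: A0_def A1_def K_tm_def M0_def M1_def P_tm_def zero_tm_def one_tm_def Delta_def
      lam_def up_def split: nat.split)

lemma rsub_closed: "rsub a N A0 = A0" "rsub a N A1 = A1"
  by (simp_all add: A0_def A1_def M0_def M1_def P_tm_def zero_tm_def one_tm_def Delta_def lam_def)

text \<open>As \<open>M0\<close> and \<open>M1\<close> are closed, the choice of the names
  \<open>x\<close>, \<open>z\<close> and \<open>\<alpha>\<close> is immaterial.\<close>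

lemma named_binders:
  "lam x (Var x \<cdot> M0) = A0" "lam x (Var x \<cdot> M1) = A1"
  "mu \<alpha> (Named \<alpha> (lam z (Named \<alpha> (Var z)))) = K_tm"
  by (simp_all add: lam_def mu_def A0_def A1_def K_tm_def up_def ren_closed)

theorem proposition4p5:
  fixes \<alpha> \<beta> x z :: nat and M' N :: trm
  assumes "M' = \<langle>Named \<beta> (lam x (Var x \<cdot> M1)), Named \<beta> (lam x (Var x \<cdot> M0))\<rangle>"
    and "N = Named \<alpha> (lam z (Named \<alpha> (Var z)))"
  shows "rsub \<beta> (mu \<alpha> N) M' \<in> SN \<and> mu \<beta> M' \<cdot> mu \<alpha> N \<notin> SN"
proof -
  have M': "M' = Lam (Var 0 \<cdot> Named \<beta> A1 \<cdot> Named \<beta> A0)"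
    by (simp add: assms(1) named_binders pair_def lift_lam_def ren_closed)
  have N: "mu \<alpha> N = K_tm" by (simp add: assms(2) named_binders)
  have "rsub \<beta> (mu \<alpha> N) M' = Lam (Var 0 \<cdot> Named \<beta> (A1 \<cdot> K_tm) \<cdot> Named \<beta> (A0 \<cdot> K_tm))"
    by (simp add: M' N rsub_closed lift_lam_def ren_closed)
  moreover have "mu \<beta> M' = Mu (Lam (Var 0 \<cdot> Named 0 A1 \<cdot> Named 0 A0))"
    by (simp add: M' mu_def ren_closed up_def)
  ultimately show ?thesis
    using not_SN_Mu_K N by (auto intro: SN_Lam SN_Var_Named_Named SN_A1_K SN_A0_K)
qed

end
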